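(* Let $d\ge1$ be an integer and let $G$ be a graph of girth at least $6$ with fractional chromatic number $\chi_f(G)\ge 8.1d$. Let $p=|V(G)|$, let $q\ge 2^{p-1}p^2$ be an integer and $c=4q+2$. Then $\chi(G[K_q])\ge 2dc-2c+2$ and $\chi\big(K_{dc}^{G[K_q]}\big)\ge 2dc-2c+2$. Consequently $f(2dc-2c+2)\le dc$.
   Context: $[m]=\{1,\dots,m\}$. $G[K_q]$ has vertex set $V(G)\times[q]$, with $(x,i)\sim(y,j)$ iff $xy\in E(G)$, or $x=y$ and $i\ne j$. For a graph $F$, $K_m^{F}$ has as vertices all maps $V(F)\to[m]$, with $f\sim g$ iff $f(x)\ne g(y)$ and $f(y)\ne g(x)$ for every edge $xy$ of $F$. The product $G\times H$ has vertex set $V(G)\times V(H)$ with $(x,y)\sim(x',y')$ iff $xx'\in E(G)$ and $yy'\in E(H)$. The Poljak–Rödl function is $f(n)=\min\{\chi(G\times H): \chi(G)=\chi(H)=n\}$ (equivalently with $\chi(G),\chi(H)\ge n$). *)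

theory Defs
  imports Main "HOL-Library.FuncSet" "HOL-Library.Extended_Nat" Complex_Main
begin

record 'a graph =
  verts :: "'a set"
  adj :: "'a \<Rightarrow> 'a \<Rightarrow> bool"

definition graph :: "'a graph \<Rightarrow> bool" where
  "graph G \<longleftrightarrow> (\<forall>u v. adj G u v \<longrightarrow> u \<in> verts G \<and> v \<in> verts G \<and> adj G v u \<and> u \<noteq> v)"

definition colouring :: "'a graph \<Rightarrow> nat \<Rightarrow> ('a \<Rightarrow> nat) \<Rightarrow> bool" where
  "colouring G k col \<longleftrightarrow> (\<forall>v\<in>verts G. col v < k) \<and>
     (\<forall>u\<in>verts G. \<forall>v\<in>verts G. adj G u v \<longrightarrow> col u \<noteq> col v)"

definition chromatic_number :: "'a graph \<Rightarrow> nat" where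
  "chromatic_number G = (LEAST k. \<exists>col. colouring G k col)"

definition multi_colouring :: "'a graph \<Rightarrow> nat \<Rightarrow> nat \<Rightarrow> ('a \<Rightarrow> nat set) \<Rightarrow> bool" where
  "multi_colouring G a b phi \<longleftrightarrow> (\<forall>v\<in>verts G. phi v \<subseteq> {0..<a} \<and> card (phi v) = b) \<and>
     (\<forall>u\<in>verts G. \<forall>v\<in>verts G. adj G u v \<longrightarrow> phi u \<inter> phi v = {})"

definition frac_chromatic_number :: "'a graph \<Rightarrow> real" where
  "frac_chromatic_number G =
     Inf {real a / real b | a b. b > 0 \<and> (\<exists>phi. multi_colouring G a b phi)}"

definition has_cycle :: "'a graph \<Rightarrow> nat \<Rightarrow> bool" where
  "has_cycle G k \<longleftrightarrow> 3 \<le> k \<and> (\<exists>vs. length vs = k \<and> distinct vs \<and> set vs \<subseteq> verts G \<and>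
      (\<forall>i<k. adj G (vs ! i) (vs ! ((i + 1) mod k))))"

definition girth :: "'a graph \<Rightarrow> enat" where
  "girth G = (INF k\<in>{k. has_cycle G k}. enat k)"

definition lex_K :: "'a graph \<Rightarrow> nat \<Rightarrow> ('a \<times> nat) graph" where
  "lex_K G q = \<lparr> verts = verts G \<times> {1..q},
     adj = (\<lambda>(x,i) (y,j). (x,i) \<in> verts G \<times> {1..q} \<and> (y,j) \<in> verts G \<times> {1..q} \<and>
                          (adj G x y \<or> (x = y \<and> i \<noteq> j))) \<rparr>"

definition exp_graph :: "nat \<Rightarrow> 'a graph \<Rightarrow> ('a \<Rightarrow> nat) graph" where
  "exp_graph m F = \<lparr> verts = verts F \<rightarrow>\<^sub>E {1..m},
     adj = (\<lambda>f g. f \<in> verts F \<rightarrow>\<^sub>E {1..m} \<and> g \<in> verts F \<rightarrow>\<^sub>E {1..m} \<and>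
                 (\<forall>x y. adj F x y \<longrightarrow> f x \<noteq> g y \<and> f y \<noteq> g x)) \<rparr>"

definition graph_prod :: "'a graph \<Rightarrow> 'b graph \<Rightarrow> ('a \<times> 'b) graph" where
  "graph_prod G H = \<lparr> verts = verts G \<times> verts H,
     adj = (\<lambda>(x,y) (x',y'). adj G x x' \<and> adj H y y') \<rparr>"

text \<open>Poljak-Roedl function, over finite simple graphs (vertices w.l.o.g. in nat).\<close>
definition poljak_rodl :: "nat \<Rightarrow> nat" where
  "poljak_rodl n = (LEAST k. \<exists>(G :: nat graph) (H :: nat graph). graph G \<and> graph H \<and>
      finite (verts G) \<and> finite (verts H) \<and>
      chromatic_number G = n \<and> chromatic_number H = n \<and>
      chromatic_number (graph_prod G H) = k)"

end

theory Submission
  imports Defs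
begin

text \<open>
  Let \<open>V\<close> be the vertex set of \<open>G\<close> and \<open>n = d * c\<close>, and suppose that the exponential graph has a proper
  colouring with few colours. Every \<open>f : V \<rightarrow> [n]\<close> gives a vertex of the exponential graph that is
  constant on fibres. If two such maps \<open>f\<close>, \<open>g\<close> share a colour, then \<open>f x \<in> g (N[x])\<close> for some \<open>x\<close>,
  so a large colour class must contain many maps with a common value \<open>f v = b\<close>, and then every map
  \<open>g\<close> in that class has \<open>b \<in> g (N[v])\<close>: the colour is centred at \<open>(v, b)\<close>. Counting the
  maps whose values avoid all centres shows that some vertex \<open>v\<close> has, for almost every \<open>b > 2 * q\<close>, a
  colour centred at \<open>(v, b)\<close>, and these colours are distinct. Now consider the maps on the blow-up that
  injectively use the values \<open>1, \<dots>, q\<close> over \<open>v\<close> and \<open>q + 1, \<dots>, 2 * q\<close> over each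
  neighbour of \<open>v\<close>, and a single value \<open>t > 2 * q\<close> elsewhere. As \<open>G\<close> has no triangles they form a
  clique of size \<open>n - 2 * q\<close>, and none of them can have a colour centred at \<open>v\<close>. So there are about
  \<open>2 * (n - 2 * q)\<close> colours.
\<close>

section \<open>Counting maps in a box with prescribed values\<close>

lemma card_PiE_two_fixed_le:
  assumes "finite V" "x0 \<in> V" "x \<in> V" "x \<noteq> x0"
    and "\<And>y. y \<in> V \<Longrightarrow> card (B y) = m" "\<And>y. y \<in> V \<Longrightarrow> finite (B y)"
  shows "card {f \<in> Pi\<^sub>E V B. f x0 = b \<and> f x = a} \<le> m ^ (card V - 2)"
proof -
  let ?C = "\<lambda>y. if y = x0 then {b} else if y = x then {a} else B y"
  have fin: "finite (Pi\<^sub>E V ?C)"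
    using assms by (intro finite_PiE) auto
  have sub: "{f \<in> Pi\<^sub>E V B. f x0 = b \<and> f x = a} \<subseteq> Pi\<^sub>E V ?C"
    by (auto simp: PiE_iff extensional_def)
  have V: "V = insert x0 (insert x (V - {x0, x}))"
    using assms by auto
  have "card (Pi\<^sub>E V ?C) = (\<Prod>y\<in>V. card (?C y))"
    using assms by (simp add: card_PiE)
  also have "\<dots> = (\<Prod>y\<in>V - {x0, x}. card (?C y))"
    using assms by (subst V) (simp add: prod.insert_remove)
  also have "\<dots> = (\<Prod>y\<in>V - {x0, x}. m)"
    using assms by (intro prod.cong) auto
  also have "\<dots> = m ^ (card V - 2)"
    using assms by (simp add: card_Diff_subset numeral_2_eq_2)
  finally show ?thesis
    using card_mono[OF fin sub] by simp
qed

lemma card_UN_le_mult: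
  assumes "finite I" "card I \<le> a" "\<And>i. i \<in> I \<Longrightarrow> card (A i) \<le> b"
  shows "card (\<Union>i\<in>I. A i) \<le> a * b"
proof -
  have "card (\<Union>i\<in>I. A i) \<le> (\<Sum>i\<in>I. card (A i))"
    using assms by (intro card_UN_le)
  also have "\<dots> \<le> card I * b"
    using sum_bounded_above[of I "\<lambda>i. card (A i)" b] assms by simp
  also have "\<dots> \<le> a * b"
    using assms by simp
  finally show ?thesis .
qed

text \<open>A union bound over the second vertex \<open>x\<close> and its value, with at most
  \<open>card V\<close> and \<open>r\<close> choices. Having two coordinates fixed is what saves a
  factor \<open>m ^ 2\<close> against the size \<open>m ^ card V\<close> of the box.\<close>

lemma card_PiE_fixed_hitting_le:
  assumes "finite V" "x0 \<in> V" "\<And>y. y \<in> V \<Longrightarrow> card (B y) = m" "\<And>y. y \<in> V \<Longrightarrow> finite (B y)"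
    and "\<And>x. x \<in> V \<Longrightarrow> card (X x \<inter> B x) \<le> r"
    and "S \<subseteq> Pi\<^sub>E V B" "\<And>f. f \<in> S \<Longrightarrow> f x0 = b \<and> (\<exists>x\<in>V - {x0}. f x \<in> X x)"
  shows "card S \<le> card V * (r * m ^ (card V - 2))"
proof -
  let ?T = "\<Union>x\<in>V - {x0}. \<Union>a\<in>X x \<inter> B x. {f \<in> Pi\<^sub>E V B. f x0 = b \<and> f x = a}"
  have "S \<subseteq> ?T"
  proof
    fix f assume f: "f \<in> S"
    then obtain x where "x \<in> V - {x0}" "f x \<in> X x" "f x0 = b" using assms(7) by blast
    moreover have "f \<in> Pi\<^sub>E V B" using f assms(6) by blast
    ultimately show "f \<in> ?T" by (auto simp: PiE_iff)
  qed
  moreover have "finite (Pi\<^sub>E V B)"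
    using assms by (intro finite_PiE) auto
  then have "finite ?T"
    by (rule finite_subset[rotated]) auto
  ultimately have "card S \<le> card ?T" by (rule card_mono[rotated])
  also have "\<dots> \<le> card V * (r * m ^ (card V - 2))"
  proof (rule card_UN_le_mult)
    fix x assume x: "x \<in> V - {x0}"
    show "card (\<Union>a\<in>X x \<inter> B x. {f \<in> Pi\<^sub>E V B. f x0 = b \<and> f x = a}) \<le> r * m ^ (card V - 2)"
      using x assms by (intro card_UN_le_mult card_PiE_two_fixed_le) auto
  qed (use assms in \<open>auto intro: card_mono\<close>)
  finally show ?thesis .
qed

section \<open>Colourings of the exponential graph of a blow-up\<close>

locale exp_lex_colouring =
  fixes G :: "'a graph" and q n k :: nat and col :: "('a \<times> nat \<Rightarrow> nat) \<Rightarrow> nat"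
  assumes G: "graph G" and fin: "finite (verts G)"
    and triangle_free: "adj G x y \<Longrightarrow> adj G x z \<Longrightarrow> \<not> adj G y z"
    and col: "colouring (exp_graph n (lex_K G q)) k col"
    and q_le: "2 * q \<le> n"
begin

abbreviation "V \<equiv> verts G"

abbreviation maps :: "('a \<times> nat \<Rightarrow> nat) set" where
  "maps \<equiv> V \<times> {1..q} \<rightarrow>\<^sub>E {1..n}"

definition pull :: "('a \<Rightarrow> nat) \<Rightarrow> 'a \<times> nat \<Rightarrow> nat" where
  "pull f = (\<lambda>(x, i) \<in> V \<times> {1..q}. f x)"

definition star_map :: "'a \<Rightarrow> nat \<Rightarrow> 'a \<times> nat \<Rightarrow> nat" where
  "star_map v t = (\<lambda>(x, i) \<in> V \<times> {1..q}. if x = v then i else if adj G v x then q + i else t)"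

definition nbhd_image :: "('a \<times> nat \<Rightarrow> nat) \<Rightarrow> 'a \<Rightarrow> nat set" where
  "nbhd_image g x = g ` ({y \<in> V. y = x \<or> adj G x y} \<times> {1..q})"

text \<open>
  Centredness must also control the star maps, whose neighbourhood images are large; but outside
  \<open>{1..2 * q}\<close>, where the maps that are counted take their values, these images are small.
\<close>

definition sparse :: "('a \<times> nat \<Rightarrow> nat) set" where
  "sparse = {g \<in> maps. \<forall>x\<in>V. card (nbhd_image g x - {1..2 * q}) \<le> card V}"

text \<open>The second conjunct makes \<open>b\<close> unique for given \<open>v\<close> and \<open>s\<close>.\<close>

definition centred :: "'a \<Rightarrow> nat \<Rightarrow> nat \<Rightarrow> bool" where
  "centred v b s \<longleftrightarrow> (\<forall>g\<in>sparse. col g = s \<longrightarrow> b \<in> nbhd_image g v) \<and>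
     (\<forall>b'. b' \<noteq> b \<longrightarrow> (\<exists>f \<in> V \<rightarrow>\<^sub>E {1..n}. col (pull f) = s \<and> f v = b \<and> (\<forall>x\<in>V - {v}. f x \<noteq> b')))"

lemma adj_sym: "adj G x y \<Longrightarrow> adj G y x"
  and adj_irrefl: "\<not> adj G x x"
  using G unfolding graph_def by blast+

lemma pull_in_maps: "f \<in> V \<rightarrow>\<^sub>E {1..n} \<Longrightarrow> pull f \<in> maps"
  by (auto simp: pull_def PiE_iff)

lemma star_map_in_maps: "t \<in> {2 * q<..n} \<Longrightarrow> star_map v t \<in> maps"
  using q_le by (auto simp: star_map_def PiE_iff)

lemma finite_nbhd_image: "finite (nbhd_image g x)"
  using fin by (auto simp: nbhd_image_def)

lemma nbhd_image_pull_subset: "nbhd_image (pull f) x \<subseteq> f ` V"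
  by (auto simp: nbhd_image_def pull_def)

lemma card_nbhd_image_pull: "card (nbhd_image (pull f) x) \<le> card V"
  by (meson nbhd_image_pull_subset card_image_le card_mono fin finite_imageI order_trans)

lemma pull_in_sparse: "f \<in> V \<rightarrow>\<^sub>E {1..n} \<Longrightarrow> pull f \<in> sparse"
  using card_nbhd_image_pull[of f] pull_in_maps[of f]
  by (auto simp: sparse_def intro: order_trans[OF card_mono[OF finite_nbhd_image Diff_subset]])

lemma star_map_in_sparse:
  assumes t: "t \<in> {2 * q<..n}"
  shows "star_map v t \<in> sparse"
proof -
  have "card (nbhd_image (star_map v t) x - {1..2 * q}) \<le> card V" if x: "x \<in> V" for x
  proof -
    have "nbhd_image (star_map v t) x - {1..2 * q} \<subseteq> {t}"
      by (auto simp: nbhd_image_def star_map_def split: if_splits)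
    then have "card (nbhd_image (star_map v t) x - {1..2 * q}) \<le> 1"
      using card_mono[of "{t}"] by simp
    also have "1 \<le> card V"
      using x fin by (simp add: Suc_le_eq card_gt_0_iff) blast
    finally show ?thesis .
  qed
  then show ?thesis
    using star_map_in_maps[OF t] by (simp add: sparse_def)
qed

lemma col_less: "g \<in> maps \<Longrightarrow> col g < k"
  using col by (auto simp: colouring_def exp_graph_def lex_K_def)

text \<open>Adjacency in the exponential graph asks for two inequalities per edge. The single one in
  the hypothesis ranges over ordered pairs and so gives both, as adjacency in \<open>G\<close> is
  symmetric.\<close>

lemma col_neq:
  assumes f: "f \<in> maps" and g: "g \<in> maps"
    and neq: "\<And>x i y j. x \<in> V \<Longrightarrow> i \<in> {1..q} \<Longrightarrow> y \<in> V \<Longrightarrow> j \<in> {1..q} \<Longrightarrow>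
      adj G x y \<or> x = y \<and> i \<noteq> j \<Longrightarrow> f (x, i) \<noteq> g (y, j)"
  shows "col f \<noteq> col g"
proof -
  have "f a \<noteq> g b \<and> f b \<noteq> g a" if ab: "adj (lex_K G q) a b" for a b
  proof (cases a; cases b)
    fix x i y j assume [simp]: "a = (x, i)" "b = (y, j)"
    have "x \<in> V" "i \<in> {1..q}" "y \<in> V" "j \<in> {1..q}" "adj G x y \<or> x = y \<and> i \<noteq> j"
      using ab by (auto simp: lex_K_def)
    then show ?thesis
      using neq[of x i y j] neq[of y j x i] adj_sym[of x y] by auto
  qed
  moreover have "verts (lex_K G q) = V \<times> {1..q}" by (simp add: lex_K_def)
  ultimately have "adj (exp_graph n (lex_K G q)) f g" "f \<in> verts (exp_graph n (lex_K G q))"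
    "g \<in> verts (exp_graph n (lex_K G q))"
    using f g by (auto simp: exp_graph_def)
  then show ?thesis using col unfolding colouring_def by blast
qed

text \<open>Otherwise \<open>pull f\<close> and \<open>g\<close> would be adjacent: every neighbour
  of \<open>(x, i)\<close> in the blow-up lies over the closed neighbourhood of \<open>x\<close>,
  and \<open>pull f\<close> takes the value \<open>f x\<close> on the whole fibre over
  \<open>x\<close>.\<close>

lemma same_colour_meets:
  assumes f: "f \<in> V \<rightarrow>\<^sub>E {1..n}" and g: "g \<in> maps" and eq: "col (pull f) = col g"
  shows "\<exists>x\<in>V. f x \<in> nbhd_image g x"
proof (rule ccontr)
  assume no: "\<not> ?thesis"
  have "col (pull f) \<noteq> col g"
  proof (rule col_neq[OF pull_in_maps[OF f] g])
    fix x i y j assume xy: "x \<in> V" "i \<in> {1..q}" "y \<in> V" "j \<in> {1..q}" "adj G x y \<or> x = y \<and> i \<noteq> j"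
    then have "g (y, j) \<in> nbhd_image g x"
      unfolding nbhd_image_def by (intro imageI) auto
    then have "g (y, j) \<noteq> f x" using no xy(1) by metis
    then show "pull f (x, i) \<noteq> g (y, j)" using xy by (simp add: pull_def)
  qed
  then show False using eq by simp
qed

text \<open>An equality of values along an edge could only occur inside one block: within a fibre
  the values are distinct, \<open>v\<close> and its neighbours use disjoint blocks, and two
  neighbours of \<open>v\<close> are not adjacent. Outside the blocks only \<open>t\<close> and
  \<open>t'\<close> occur.\<close>

lemma col_star_map_neq:
  assumes "t \<in> {2 * q<..n}" "t' \<in> {2 * q<..n}" "t \<noteq> t'"
  shows "col (star_map v t) \<noteq> col (star_map v t')"
proof (rule col_neq[OF star_map_in_maps[OF assms(1)] star_map_in_maps[OF assms(2)]])
  fix x i y j assume xy: "x \<in> V" "i \<in> {1..q}" "y \<in> V" "j \<in> {1..q}" "adj G x y \<or> x = y \<and> i \<noteq> j"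
  moreover have "\<not> (adj G x y \<and> adj G v x \<and> adj G v y)"
    using triangle_free[of v x y] by blast
  ultimately show "star_map v t (x, i) \<noteq> star_map v t' (y, j)"
    using assms adj_irrefl[of x] by (auto simp: star_map_def)
qed

text \<open>The map \<open>f\<close> that centredness at \<open>b\<close> provides against
  \<open>b'\<close> never takes the value \<open>b'\<close>, yet its sparse pullback has colour
  \<open>s\<close>, so centredness at \<open>b'\<close> puts \<open>b'\<close> into its
  image.\<close>

lemma centred_unique:
  assumes "centred v b s" "centred v b' s"
  shows "b = b'"
proof (rule ccontr)
  assume "b \<noteq> b'"
  then obtain f where f: "f \<in> V \<rightarrow>\<^sub>E {1..n}" "col (pull f) = s" "f v = b" "\<forall>x\<in>V - {v}. f x \<noteq> b'"
    using assms(1) unfolding centred_def by metis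
  then have "b' \<in> nbhd_image (pull f) v"
    using assms(2) pull_in_sparse unfolding centred_def by blast
  then have "b' \<in> f ` V" using nbhd_image_pull_subset by blast
  then show False using f \<open>b \<noteq> b'\<close> by auto
qed

text \<open>Over the closed neighbourhood of \<open>v\<close> a star map takes only values up to
  \<open>2 * q\<close>.\<close>

lemma star_map_avoids_centred:
  assumes "t \<in> {2 * q<..n}" "b > 2 * q"
  shows "\<not> centred v b (col (star_map v t))"
proof
  assume "centred v b (col (star_map v t))"
  then have "b \<in> nbhd_image (star_map v t) v"
    using star_map_in_sparse[OF assms(1)] unfolding centred_def by blast
  then show False
    using assms(2) adj_irrefl[of v] by (auto simp: nbhd_image_def star_map_def split: if_splits)
qed

section \<open>Counting the maps that avoid all centres\<close>

text \<open>Each way of failing to be centred forces a second coordinate into a small set. Either a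
  sparse \<open>g\<close> of colour \<open>s\<close> misses \<open>b\<close> near \<open>x0\<close>,
  and every \<open>f\<close> counted must meet \<open>g\<close> at another vertex; or some fixed
  \<open>b'\<close> is taken by every such \<open>f\<close> at another vertex.\<close>

lemma card_uncentred_pulls_le:
  assumes "x0 \<in> V" "\<And>y. y \<in> V \<Longrightarrow> B y \<subseteq> {2 * q<..n} \<and> card (B y) = m"
    and nc: "\<not> centred x0 b s"
  shows "card {f \<in> Pi\<^sub>E V B. col (pull f) = s \<and> f x0 = b} \<le> card V * (card V * m ^ (card V - 2))"
    (is "card ?S \<le> _")
proof -
  have finB: "finite (B y)" if "y \<in> V" for y
    using assms(2)[OF that] finite_subset by blast
  have PiB: "f \<in> V \<rightarrow>\<^sub>E {1..n}" if "f \<in> Pi\<^sub>E V B" for f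
    using PiE_mono[of V B "\<lambda>_. {1..n}"] assms(2) that by fastforce
  consider g where "g \<in> sparse" "col g = s" "b \<notin> nbhd_image g x0"
    | b' where "\<And>f. f \<in> V \<rightarrow>\<^sub>E {1..n} \<Longrightarrow> col (pull f) = s \<Longrightarrow> f x0 = b \<Longrightarrow> \<exists>x\<in>V - {x0}. f x = b'"
  proof (cases "\<forall>g\<in>sparse. col g = s \<longrightarrow> b \<in> nbhd_image g x0")
    case True
    then obtain b' where "\<not> (\<exists>f \<in> V \<rightarrow>\<^sub>E {1..n}. col (pull f) = s \<and> f x0 = b \<and> (\<forall>x\<in>V - {x0}. f x \<noteq> b'))"
      using nc unfolding centred_def by metis
    then show ?thesis using that(2)[of b'] by metis
  next
    case False
    then show ?thesis using that(1) by metis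
  qed
  then show ?thesis
  proof cases
    case 1
    show ?thesis
    proof (rule card_PiE_fixed_hitting_le[where X = "nbhd_image g"])
      fix x assume x: "x \<in> V"
      \<comment> \<open>Sparseness bounds only the values above \<open>2 * q\<close>, which suffices
        because \<open>B x\<close> contains no others.\<close>
      have "nbhd_image g x \<inter> B x \<subseteq> nbhd_image g x - {1..2 * q}"
        using assms(2)[OF x] by auto
      then have "card (nbhd_image g x \<inter> B x) \<le> card (nbhd_image g x - {1..2 * q})"
        by (intro card_mono) (simp_all add: finite_nbhd_image)
      also have "\<dots> \<le> card V"
        using 1(1) x by (simp add: sparse_def)
      finally show "card (nbhd_image g x \<inter> B x) \<le> card V" .
    next
      fix f assume f: "f \<in> ?S"
      then have "f \<in> V \<rightarrow>\<^sub>E {1..n}" "col (pull f) = col g"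
        using PiB[of f] 1(2) by simp_all
      moreover have "g \<in> maps" using 1(1) by (simp add: sparse_def)
      ultimately obtain x where "x \<in> V" "f x \<in> nbhd_image g x"
        using same_colour_meets by blast
      then show "f x0 = b \<and> (\<exists>x\<in>V - {x0}. f x \<in> nbhd_image g x)"
        using f 1(3) by auto
    qed (use assms fin finB in auto)
  next
    case 2
    show ?thesis
    proof (rule card_PiE_fixed_hitting_le[where X = "\<lambda>_. {b'}"])
      fix x assume x: "x \<in> V"
      have "card ({b'} \<inter> B x) \<le> 1"
        using card_mono[of "{b'}" "{b'} \<inter> B x"] by simp
      also have "1 \<le> card V"
        using x fin by (simp add: Suc_le_eq card_gt_0_iff) blast
      finally show "card ({b'} \<inter> B x) \<le> card V" .
    next
      fix f assume "f \<in> ?S"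
      then show "f x0 = b \<and> (\<exists>x\<in>V - {x0}. f x \<in> {b'})"
        using 2[of f] PiB by auto
    qed (use assms fin finB in auto)
  qed
qed

text \<open>Otherwise every vertex has a set \<open>B v\<close> of \<open>m\<close> values at which
  no colour is centred. Fix one member \<open>g\<close> of a colour class in this box: every member
  agrees with one of at most \<open>card V\<close> values of \<open>g\<close> at one of
  \<open>card V\<close> vertices, and each such choice leaves at most \<open>r\<close> maps. So
  \<open>k\<close> classes cover at most \<open>k * card V ^ 4 * m ^ (card V - 2)\<close> of the
  \<open>m ^ card V\<close> maps, too few.\<close>

lemma ex_vertex_mostly_centred:
  assumes p: "card V \<ge> 2" and m: "k * card V ^ 4 < m\<^sup>2"
  shows "\<exists>v\<in>V. card {b \<in> {2 * q<..n}. \<forall>s. \<not> centred v b s} < m"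
proof (rule ccontr)
  let ?bad = "\<lambda>v. {b \<in> {2 * q<..n}. \<forall>s. \<not> centred v b s}"
  assume "\<not> ?thesis"
  then have bad: "m \<le> card (?bad v)" if "v \<in> V" for v
    using that by (simp add: not_less)
  have "\<exists>B. B \<subseteq> ?bad v \<and> card B = m" if "v \<in> V" for v
    using obtain_subset_with_card_n[OF bad[OF that]] by blast
  then obtain B where B: "\<And>v. v \<in> V \<Longrightarrow> B v \<subseteq> ?bad v \<and> card (B v) = m"
    by metis
  define r where "r = card V * (card V * m ^ (card V - 2))"
  have B': "B v \<subseteq> {2 * q<..n} \<and> card (B v) = m" if "v \<in> V" for v
    using B[OF that] by auto
  have finB: "finite (B y)" if "y \<in> V" for y
    using B'[OF that] finite_subset by blast
  have PiB: "f \<in> V \<rightarrow>\<^sub>E {1..n}" if "f \<in> Pi\<^sub>E V B" for f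
    using PiE_mono[of V B "\<lambda>_. {1..n}"] B' that by fastforce
  have finP: "finite (Pi\<^sub>E V B)"
    using fin finB by (intro finite_PiE) auto
  have class_le: "card {f \<in> Pi\<^sub>E V B. col (pull f) = s} \<le> card V * (card V * r)" for s
  proof (cases "{f \<in> Pi\<^sub>E V B. col (pull f) = s} = {}")
    case True
    then show ?thesis by (simp only: card.empty le0)
  next
    case False
    then obtain g where g: "g \<in> Pi\<^sub>E V B" "col (pull g) = s" by auto
    let ?T = "\<Union>x\<in>V. \<Union>b\<in>nbhd_image (pull g) x \<inter> B x. {f \<in> Pi\<^sub>E V B. col (pull f) = s \<and> f x = b}"
    have "{f \<in> Pi\<^sub>E V B. col (pull f) = s} \<subseteq> ?T"
    proof
      fix f assume f: "f \<in> {f \<in> Pi\<^sub>E V B. col (pull f) = s}"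
      then obtain x where x: "x \<in> V" "f x \<in> nbhd_image (pull g) x"
        using same_colour_meets[of f "pull g"] PiB g pull_in_maps by auto
      moreover have "f x \<in> B x" using f x by auto
      ultimately show "f \<in> ?T" using f by auto
    qed
    moreover have "finite ?T"
      using finP by (rule finite_subset[rotated]) auto
    ultimately have "card {f \<in> Pi\<^sub>E V B. col (pull f) = s} \<le> card ?T"
      by (rule card_mono[rotated])
    also have "\<dots> \<le> card V * (card V * r)"
    proof (intro card_UN_le_mult)
      fix x assume "x \<in> V"
      show "card (nbhd_image (pull g) x \<inter> B x) \<le> card V"
        using card_mono[OF finite_nbhd_image Int_lower1] card_nbhd_image_pull order_trans by metis
    next
      fix x b assume "x \<in> V" "b \<in> nbhd_image (pull g) x \<inter> B x"
      then show "card {f \<in> Pi\<^sub>E V B. col (pull f) = s \<and> f x = b} \<le> r"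
        unfolding r_def using B[of x] B' by (intro card_uncentred_pulls_le) auto
    qed (use fin finite_nbhd_image in auto)
    finally show ?thesis .
  qed
  have "m ^ card V = card (Pi\<^sub>E V B)"
    using fin B' by (simp add: card_PiE)
  also have "Pi\<^sub>E V B = (\<Union>s\<in>{..<k}. {f \<in> Pi\<^sub>E V B. col (pull f) = s})"
    using PiB pull_in_maps col_less by auto
  also have "card \<dots> \<le> k * (card V * (card V * r))"
    using class_le by (intro card_UN_le_mult) auto
  also have "\<dots> = k * card V ^ 4 * m ^ (card V - 2)"
    by (simp add: r_def eval_nat_numeral)
  also have "\<dots> < m\<^sup>2 * m ^ (card V - 2)"
    using m by (intro mult_strict_right_mono) (auto intro!: Nat.gr0I)
  also have "\<dots> = m ^ card V"
    using p by (metis le_add_diff_inverse power_add)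
  finally show False by simp
qed

text \<open>Of the \<open>n - 2 * q\<close> values above \<open>2 * q\<close>, fewer than
  \<open>m\<close> fail to give a colour centred at \<open>v\<close>; the star maps at
  \<open>v\<close> use \<open>n - 2 * q\<close> further colours.\<close>

lemma colours_lower_bound:
  assumes "card V \<ge> 2" "k * card V ^ 4 < m\<^sup>2"
  shows "2 * n < k + 4 * q + m"
proof -
  obtain v where v: "v \<in> V" "card {b \<in> {2 * q<..n}. \<forall>s. \<not> centred v b s} < m"
    using ex_vertex_mostly_centred[OF assms] by blast
  define good where "good = {b \<in> {2 * q<..n}. \<exists>s. centred v b s}"
  have "\<forall>b\<in>good. \<exists>s. centred v b s"
    by (simp add: good_def)
  then obtain c where c: "\<And>b. b \<in> good \<Longrightarrow> centred v b (c b)"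
    by metis
  have "inj_on c good"
    using c centred_unique by (metis inj_onI)
  moreover have c_less: "c b < k" if "b \<in> good" for b
  proof -
    have "Suc b \<noteq> b" by simp
    then have "\<exists>f \<in> V \<rightarrow>\<^sub>E {1..n}. col (pull f) = c b"
      using c[OF \<open>b \<in> good\<close>] unfolding centred_def by blast
    then show ?thesis using col_less pull_in_maps by metis
  qed
  moreover have "inj_on (\<lambda>t. col (star_map v t)) {2 * q<..n}"
    unfolding inj_on_def using col_star_map_neq by blast
  moreover have "c ` good \<inter> (\<lambda>t. col (star_map v t)) ` {2 * q<..n} = {}"
  proof -
    have "c b \<noteq> col (star_map v t)" if "b \<in> good" "t \<in> {2 * q<..n}" for b t
      using star_map_avoids_centred[OF that(2), of b v] c[OF that(1)] that(1) by (auto simp: good_def)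
    then show ?thesis by auto
  qed
  moreover have "c ` good \<union> (\<lambda>t. col (star_map v t)) ` {2 * q<..n} \<subseteq> {..<k}"
    using c_less col_less star_map_in_maps by auto
  ultimately have "card good + (n - 2 * q) \<le> k"
    using card_mono[of "{..<k}" "c ` good \<union> (\<lambda>t. col (star_map v t)) ` {2 * q<..n}"]
    by (simp add: card_Un_disjoint card_image good_def)
  moreover have "card good + card {b \<in> {2 * q<..n}. \<forall>s. \<not> centred v b s} = n - 2 * q"
  proof -
    have "good \<union> {b \<in> {2 * q<..n}. \<forall>s. \<not> centred v b s} = {2 * q<..n}"
      by (auto simp: good_def)
    moreover have "good \<inter> {b \<in> {2 * q<..n}. \<forall>s. \<not> centred v b s} = {}"
      by (auto simp: good_def)
    ultimately show ?thesis
      using card_Un_disjoint[of good "{b \<in> {2 * q<..n}. \<forall>s. \<not> centred v b s}"]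
      by (simp add: good_def)
  qed
  ultimately show ?thesis using v(2) q_le by linarith
qed

end

section \<open>Chromatic numbers and the Poljak-Roedl function\<close>

lemma ex_colouring:
  assumes "finite (verts G)" "graph G"
  shows "\<exists>k col. colouring G k col"
proof -
  obtain col :: "'a \<Rightarrow> nat" and k where "col ` verts G = {i. i < k}" "inj_on col (verts G)"
    using finite_imp_inj_to_nat_seg[OF assms(1)] by auto
  then have "colouring G k col"
    using assms(2) by (auto simp: colouring_def graph_def dest: inj_onD)
  then show ?thesis by blast
qed

lemma chromatic_number_colouring:
  assumes "finite (verts G)" "graph G"
  shows "\<exists>col. colouring G (chromatic_number G) col"
  unfolding chromatic_number_def using ex_colouring[OF assms] by (rule LeastI_ex)

lemma chromatic_number_le: "colouring G k col \<Longrightarrow> chromatic_number G \<le> k"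
  unfolding chromatic_number_def by (rule Least_le) blast

text \<open>Keeping only the first \<open>n\<close> classes of an optimal colouring lowers the chromatic number to exactly \<open>n\<close>.\<close>

lemma ex_nat_graph_chromatic_number_eq:
  fixes G :: "'a graph"
  assumes fin: "finite (verts G)" and G: "graph G" and n: "n \<le> chromatic_number G"
  obtains H :: "nat graph" and h where "graph H" "finite (verts H)" "chromatic_number H = n"
    "h ` verts H \<subseteq> verts G" "\<And>u v. adj H u v \<Longrightarrow> adj G (h u) (h v)"
proof -
  obtain col where col: "colouring G (chromatic_number G) col"
    using chromatic_number_colouring[OF fin G] by blast
  define S where "S = {v \<in> verts G. col v < n}"
  have finS: "finite S" using fin by (simp add: S_def)
  obtain e :: "'a \<Rightarrow> nat" where e: "inj_on e S"
    using finite_imp_inj_to_nat_seg[OF finS] by auto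
  define h where "h = the_inv_into S e"
  have h: "h (e x) = x" if "x \<in> S" for x
    using e that by (simp add: h_def the_inv_into_f_f)
  define H where "H = \<lparr>verts = e ` S, adj = (\<lambda>u v. \<exists>x\<in>S. \<exists>y\<in>S. u = e x \<and> v = e y \<and> adj G x y)\<rparr>"
  have gH: "graph H"
    using G e by (auto simp: graph_def H_def dest: inj_onD)
  have finH: "finite (verts H)" using finS by (simp add: H_def)
  have sub: "h ` verts H \<subseteq> verts G"
    using h by (auto simp: H_def S_def)
  have hom: "adj G (h u) (h v)" if "adj H u v" for u v
    using that h by (auto simp: H_def)
  have "colouring H n (col \<circ> h)"
    unfolding colouring_def
  proof (intro conjI ballI impI)
    fix u assume "u \<in> verts H"
    then show "(col \<circ> h) u < n" using h by (auto simp: H_def S_def)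
  next
    fix u v assume "u \<in> verts H" "v \<in> verts H" "adj H u v"
    then have "h u \<in> verts G" "h v \<in> verts G" "adj G (h u) (h v)"
      using hom sub by auto
    then show "(col \<circ> h) u \<noteq> (col \<circ> h) v"
      using col by (simp add: colouring_def)
  qed
  then have "chromatic_number H \<le> n" by (rule chromatic_number_le)
  moreover have "\<not> chromatic_number H < n"
  proof
    assume less: "chromatic_number H < n"
    obtain c where c: "colouring H (chromatic_number H) c"
      using chromatic_number_colouring[OF finH gH] by blast
    \<comment> \<open>The first \<open>n\<close> classes are recoloured as in \<open>H\<close>, and
      the remaining ones are moved down to start right after the colours of \<open>H\<close>; this
      would save colours on \<open>G\<close>.\<close>
    let ?c = "\<lambda>v. if col v < n then c (e v) else col v - n + chromatic_number H"
    have "colouring G (chromatic_number G - n + chromatic_number H) ?c"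
      unfolding colouring_def
    proof (intro conjI ballI impI)
      fix v assume v: "v \<in> verts G"
      then have "col v < chromatic_number G" using col by (simp add: colouring_def)
      moreover have "c (e v) < chromatic_number H" if "col v < n"
        using c v that by (simp add: colouring_def H_def S_def)
      ultimately show "?c v < chromatic_number G - n + chromatic_number H"
        by auto
    next
      fix u v assume uv: "u \<in> verts G" "v \<in> verts G" "adj G u v"
      then have "col u \<noteq> col v" using col by (simp add: colouring_def)
      moreover have "c (e u) < chromatic_number H" if "col u < n"
        using c uv that by (simp add: colouring_def H_def S_def)
      moreover have "c (e v) < chromatic_number H" if "col v < n"
        using c uv that by (simp add: colouring_def H_def S_def)
      moreover have "c (e u) \<noteq> c (e v)" if "col u < n" "col v < n"
      proof -
        have "u \<in> S" "v \<in> S" using uv that by (auto simp: S_def)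
        then have "adj H (e u) (e v)" "e u \<in> verts H" "e v \<in> verts H"
          using uv by (auto simp: H_def)
        then show ?thesis using c by (auto simp: colouring_def)
      qed
      ultimately show "?c u \<noteq> ?c v" by auto
    qed
    then have "chromatic_number G \<le> chromatic_number G - n + chromatic_number H"
      by (rule chromatic_number_le)
    then show False using less n by linarith
  qed
  ultimately have "chromatic_number H = n" by simp
  then show ?thesis using that gH finH sub hom by blast
qed

text \<open>Allows factors of chromatic number above \<open>n\<close> and of any vertex type: both
  are cut down to chromatic number exactly \<open>n\<close> over \<open>nat\<close>, and
  \<open>c\<close> is pulled back along the two homomorphisms.\<close>

lemma poljak_rodl_le:
  assumes "graph A" "finite (verts A)" "n \<le> chromatic_number A"
    and "graph B" "finite (verts B)" "n \<le> chromatic_number B"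
    and c: "colouring (graph_prod A B) m c"
  shows "poljak_rodl n \<le> m"
proof -
  obtain H1 :: "nat graph" and h1 where H1: "graph H1" "finite (verts H1)" "chromatic_number H1 = n"
    "h1 ` verts H1 \<subseteq> verts A" "\<And>u v. adj H1 u v \<Longrightarrow> adj A (h1 u) (h1 v)"
    using ex_nat_graph_chromatic_number_eq[OF assms(2,1,3)] by blast
  obtain H2 :: "nat graph" and h2 where H2: "graph H2" "finite (verts H2)" "chromatic_number H2 = n"
    "h2 ` verts H2 \<subseteq> verts B" "\<And>u v. adj H2 u v \<Longrightarrow> adj B (h2 u) (h2 v)"
    using ex_nat_graph_chromatic_number_eq[OF assms(5,4,6)] by blast
  have "poljak_rodl n \<le> chromatic_number (graph_prod H1 H2)"
    unfolding poljak_rodl_def using H1 H2 by (intro Least_le) blast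
  also have "colouring (graph_prod H1 H2) m (\<lambda>(u, v). c (h1 u, h2 v))"
  proof -
    have "c (h1 u, h2 v) < m" if "u \<in> verts H1" "v \<in> verts H2" for u v
      using c that H1(4) H2(4) by (auto simp: colouring_def graph_prod_def)
    moreover have "c (h1 u, h2 v) \<noteq> c (h1 u', h2 v')"
      if "u \<in> verts H1" "v \<in> verts H2" "u' \<in> verts H1" "v' \<in> verts H2" "adj H1 u u'" "adj H2 v v'" for u v u' v'
      using c that(1-4) H1(4) H2(4) H1(5)[OF that(5)] H2(5)[OF that(6)]
      by (fastforce simp: colouring_def graph_prod_def image_subset_iff)
    ultimately show ?thesis
      by (auto simp: colouring_def graph_prod_def)
  qed
  then have "chromatic_number (graph_prod H1 H2) \<le> m" by (rule chromatic_number_le)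
  finally show ?thesis .
qed

text \<open>Evaluation is a proper colouring by the very definition of adjacency in the exponential
  graph. The shift by one takes the values in \<open>{1..m}\<close> to colours below
  \<open>m\<close>.\<close>

lemma colouring_graph_prod_exp_graph:
  "colouring (graph_prod F (exp_graph m F)) m (\<lambda>(x, f). f x - 1)"
proof -
  have "f x - 1 < m" if "x \<in> verts F" "f \<in> verts F \<rightarrow>\<^sub>E {1..m}" for x f
    using PiE_mem[OF that(2,1)] by auto
  moreover have "f x - 1 \<noteq> g y - 1"
    if "x \<in> verts F" "y \<in> verts F" "f \<in> verts F \<rightarrow>\<^sub>E {1..m}" "g \<in> verts F \<rightarrow>\<^sub>E {1..m}" "f x \<noteq> g y" for x y f g
    using PiE_mem[OF that(3,1)] PiE_mem[OF that(4,2)] that(5) by auto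
  ultimately show ?thesis
    by (auto simp: colouring_def graph_prod_def exp_graph_def)
qed

section \<open>Fractional colourings and the blow-up\<close>

lemma frac_chromatic_number_le:
  assumes "multi_colouring G a b phi" "b > 0"
  shows "frac_chromatic_number G \<le> real a / real b"
  unfolding frac_chromatic_number_def
  using assms by (intro cInf_lower bdd_belowI[of _ 0]) auto

lemma frac_chromatic_number_le_card:
  assumes "finite (verts G)" "graph G"
  shows "frac_chromatic_number G \<le> real (card (verts G))"
proof -
  obtain e where e: "bij_betw e (verts G) {0..<card (verts G)}"
    using ex_bij_betw_finite_nat[OF assms(1)] by blast
  have "multi_colouring G (card (verts G)) 1 (\<lambda>v. {e v})"
    using e assms(2) by (auto simp: multi_colouring_def graph_def bij_betw_def dest: inj_onD)
  from frac_chromatic_number_le[OF this] show ?thesis by simp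
qed

lemma graph_lex_K: "graph G \<Longrightarrow> graph (lex_K G q)"
  by (auto simp: graph_def lex_K_def)

text \<open>The fibre over a vertex is a clique of size \<open>q\<close>, so its colours form a
  \<open>q\<close>-set, and these sets are disjoint for adjacent vertices.\<close>

lemma colouring_lex_K_frac_chromatic_number:
  assumes col: "colouring (lex_K G q) k col" and q: "q > 0"
  shows "real q * frac_chromatic_number G \<le> real k"
proof -
  have neq: "col (x, i) \<noteq> col (y, j)"
    if "x \<in> verts G" "y \<in> verts G" "i \<in> {1..q}" "j \<in> {1..q}" "adj G x y \<or> x = y \<and> i \<noteq> j" for x y i j
    using col that unfolding colouring_def lex_K_def by fastforce
  have less: "col (x, i) < k" if "x \<in> verts G" "i \<in> {1..q}" for x i
    using col that by (auto simp: colouring_def lex_K_def)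
  have "card ((\<lambda>i. col (x, i)) ` {1..q}) = q" if "x \<in> verts G" for x
  proof (subst card_image)
    show "inj_on (\<lambda>i. col (x, i)) {1..q}"
      using neq[OF that that] by (metis inj_onI)
  qed simp
  then have "multi_colouring G k q (\<lambda>x. (\<lambda>i. col (x, i)) ` {1..q})"
    using neq less by (fastforce simp: multi_colouring_def)
  from frac_chromatic_number_le[OF this q] show ?thesis
    using q by (simp add: field_simps)
qed

section \<open>Loops, triangles and a growth estimate\<close>

text \<open>A loop at \<open>f\<close> would make \<open>f\<close> itself, shifted down by one, a
  proper colouring of \<open>F\<close> with \<open>m\<close> colours.\<close>

lemma graph_exp_graph:
  assumes F: "graph F" and loopless: "\<And>col. \<not> colouring F m col"
  shows "graph (exp_graph m F)"
proof -
  have "f \<noteq> g" if "adj (exp_graph m F) f g" for f g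
  proof
    assume "f = g"
    then have f: "f \<in> verts F \<rightarrow>\<^sub>E {1..m}" "\<And>x y. adj F x y \<Longrightarrow> f x \<noteq> f y"
      using that by (auto simp: exp_graph_def)
    have pos: "f x \<ge> 1 \<and> f x \<le> m" if "x \<in> verts F" for x
      using PiE_mem[OF f(1) that] by simp
    have "colouring F m (\<lambda>x. f x - 1)"
      unfolding colouring_def
    proof (intro conjI ballI impI)
      fix x assume "x \<in> verts F"
      then show "f x - 1 < m" using pos[of x] by linarith
    next
      fix x y assume "x \<in> verts F" "y \<in> verts F" "adj F x y"
      then show "f x - 1 \<noteq> f y - 1" using pos[of x] pos[of y] f(2)[of x y] by linarith
    qed
    then show False using loopless by blast
  qed
  moreover have "adj (exp_graph m F) g f" if "adj (exp_graph m F) f g" for f g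
    using that F by (simp add: exp_graph_def graph_def) metis
  moreover have "f \<in> verts (exp_graph m F) \<and> g \<in> verts (exp_graph m F)" if "adj (exp_graph m F) f g" for f g
    using that by (simp add: exp_graph_def)
  ultimately show ?thesis
    unfolding graph_def by blast
qed

lemma triangle_free_if_girth_ge:
  assumes "girth G \<ge> 4" and G: "graph G" "adj G x y" "adj G x z"
  shows "\<not> adj G y z"
proof
  assume yz: "adj G y z"
  have xs: "adj G z x" "x \<noteq> y" "y \<noteq> z" "x \<noteq> z" "x \<in> verts G" "y \<in> verts G" "z \<in> verts G"
    using G yz by (auto simp: graph_def)
  have "adj G ([x, y, z] ! i) ([x, y, z] ! ((i + 1) mod 3))" if "i < 3" for i
  proof -
    have "i = 0 \<or> i = 1 \<or> i = 2" using that by linarith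
    then show ?thesis using G yz xs by (elim disjE) auto
  qed
  then have "has_cycle G 3"
    unfolding has_cycle_def using xs by (intro conjI exI[of _ "[x, y, z]"]) auto
  then have "girth G \<le> enat 3"
    unfolding girth_def by (intro INF_lower) simp
  with assms(1) have "(4::enat) \<le> enat 3" by (rule order_trans)
  then show False by (simp add: numeral_eq_enat)
qed

text \<open>With \<open>8 * d \<le> p\<close> and the lower bound on \<open>q\<close>, this yields
  \<open>d * p ^ 4 \<le> 2 * q\<close>.\<close>

lemma cube_le_two_power:
  fixes p :: nat
  assumes "p \<ge> 9"
  shows "p ^ 3 \<le> 16 * 2 ^ (p - 1)"
  using assms
proof (induction p rule: nat_induct_at_least)
  case base
  then show ?case by simp
next
  case (Suc p)
  have "9 * (p * p) \<le> p * (p * p)" "9 * p \<le> p * p" "9 \<le> p"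
    using Suc.hyps by (auto intro: mult_right_mono)
  moreover have "Suc p ^ 3 = p * (p * p) + 3 * (p * p) + 3 * p + 1"
    by (simp add: power3_eq_cube algebra_simps)
  ultimately have "Suc p ^ 3 \<le> 2 * (p * (p * p))"
    by linarith
  also have "\<dots> = 2 * p ^ 3"
    by (simp add: power3_eq_cube)
  also have "\<dots> \<le> 2 * (16 * 2 ^ (p - 1))"
    using Suc.IH by simp
  also have "\<dots> = 16 * 2 ^ (Suc p - 1)"
    using Suc.hyps by (cases p) auto
  finally show ?case .
qed

section \<open>Choice of parameters and conclusion\<close>

theorem theorem7:
  fixes G :: "'a graph" and d p q c :: nat
  assumes "graph G" and "finite (verts G)"
    and "d \<ge> 1"
    and "girth G \<ge> 6"
    and "frac_chromatic_number G \<ge> 81/10 * real d"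
    and "p = card (verts G)"
    and "q \<ge> 2 ^ (p - 1) * p ^ 2"
    and "c = 4 * q + 2"
  shows "chromatic_number (lex_K G q) \<ge> 2 * d * c - 2 * c + 2
    \<and> chromatic_number (exp_graph (d * c) (lex_K G q)) \<ge> 2 * d * c - 2 * c + 2
    \<and> poljak_rodl (2 * d * c - 2 * c + 2) \<le> d * c"
proof -
  let ?F = "lex_K G q" and ?n = "2 * d * c - 2 * c + 2"
  let ?E = "exp_graph (d * c) ?F"
  have "81/10 * real d \<le> real p"
    using assms(5) frac_chromatic_number_le_card[OF assms(2,1)] assms(6) by simp
  then have dp: "8 * d \<le> p" and p: "p \<ge> 9"
    using assms(3) by linarith+
  have "8 * (d * p ^ 4) \<le> p * p ^ 4"
    using dp mult_le_mono1[OF dp, of "p ^ 4"] by simp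
  also have "\<dots> = p ^ 3 * p ^ 2"
    by (simp add: eval_nat_numeral)
  also have "\<dots> \<le> (16 * 2 ^ (p - 1)) * p ^ 2"
    using cube_le_two_power[OF p] by (rule mult_le_mono1)
  also have "\<dots> \<le> 16 * q"
    using assms(7) by simp
  finally have dp4: "d * p ^ 4 \<le> 2 * q" by simp
  have "d * 2 \<le> d * p ^ 4"
    using p self_le_power[of p 4] by (intro mult_le_mono) auto
  then have dq: "d \<le> q" using dp4 by linarith
  have q: "q > 0" using dq assms(3) by linarith
  have dc: "d * c = 4 * (d * q) + 2 * d"
    by (simp add: assms(8) algebra_simps)
  have c_le: "c \<le> d * c"
    using assms(3) by simp
  \<comment> \<open>As \<open>c \<le> d * c\<close>, the truncated subtraction in \<open>?n\<close>
    is exact.\<close>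
  have "?n = 2 * (d * c) - 2 * c + 2" by simp
  then have n: "?n + 8 * q + 2 = 8 * (d * q) + 4 * d"
    using c_le dc assms(8) by linarith
  have col_lex: "81 * (d * q) \<le> 10 * k" if "colouring ?F k col" for k col
  proof -
    have "real q * (81/10 * real d) \<le> real k"
      using colouring_lex_K_frac_chromatic_number[OF that q] mult_left_mono[OF assms(5), of "real q"]
      by linarith
    then have "real (81 * (d * q)) \<le> real (10 * k)"
      by (simp add: algebra_simps)
    then show ?thesis by (simp only: of_nat_le_iff)
  qed
  have F: "graph ?F" "finite (verts ?F)"
    using graph_lex_K[OF assms(1)] assms(2) by (auto simp: lex_K_def)
  have chi_F: "?n \<le> chromatic_number ?F"
  proof -
    obtain col where "colouring ?F (chromatic_number ?F) col"
      using chromatic_number_colouring[OF F(2,1)] by blast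
    \<comment> \<open>From \<open>d \<le> q\<close> follows \<open>4 * d \<le> 8 * q\<close>, hence
      \<open>?n \<le> 8 * (d * q)\<close>, below the fractional bound
      \<open>81/10 * (d * q)\<close>.\<close>
    from col_lex[OF this] show ?thesis using n dq by linarith
  qed
  have E: "graph ?E" "finite (verts ?E)"
  proof -
    have "\<not> colouring ?F (d * c) col" for col
    proof
      assume "colouring ?F (d * c) col"
      from col_lex[OF this] have "41 * (d * q) \<le> 20 * d" unfolding dc by simp
      moreover have "d * 1 \<le> d * q" using q by (intro mult_le_mono) auto
      ultimately show False using assms(3) by linarith
    qed
    then show "graph ?E" using graph_exp_graph[OF F(1)] by blast
    show "finite (verts ?E)"
      using F(2) by (auto simp: exp_graph_def intro!: finite_PiE)
  qed
  have girth4: "girth G \<ge> 4"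
    using assms(4) by (rule order_trans[rotated]) simp
  have chi_E: "?n \<le> chromatic_number ?E"
  proof (rule ccontr)
    let ?k = "chromatic_number ?E"
    assume "\<not> ?n \<le> ?k"
    then have k: "?k + 8 * q + 3 \<le> 8 * (d * q) + 4 * d" using n by linarith
    obtain col where col: "colouring ?E ?k col"
      using chromatic_number_colouring[OF E(2,1)] by blast
    interpret exp_lex_colouring G q "d * c" ?k col
    proof
      fix x y z assume "adj G x y" "adj G x z"
      with girth4 assms(1) show "\<not> adj G y z" by (rule triangle_free_if_girth_ge)
    next
      show "2 * q \<le> d * c" using c_le assms(8) by linarith
    qed (fact assms(1) assms(2) col)+
    \<comment> \<open>The bound is applied with \<open>m = 4 * q + 3\<close>, the largest
      \<open>m\<close> that still gives \<open>?n\<close>: it yields at least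
      \<open>2 * (d * c) - 4 * q - m + 1\<close> colours, which is
      \<open>2 * (d * c) - 2 * c + 2\<close>.\<close>
    have "?k \<le> 4 * (2 * q + 1) * d"
      using k by (simp add: algebra_simps)
    then have "?k * p ^ 4 \<le> 4 * (2 * q + 1) * d * p ^ 4"
      by (rule mult_le_mono1)
    also have "\<dots> = 4 * (2 * q + 1) * (d * p ^ 4)"
      by simp
    also have "\<dots> \<le> 4 * (2 * q + 1) * (2 * q)"
      using dp4 by (rule mult_le_mono2)
    also have "\<dots> < (4 * q + 3)\<^sup>2"
      by (simp add: power2_eq_square algebra_simps)
    finally have "2 * (d * c) < ?k + 4 * q + (4 * q + 3)"
      using colours_lower_bound[of "4 * q + 3"] p assms(6) by simp
    then show False using k dc by linarith
  qed
  have "poljak_rodl ?n \<le> d * c"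
    using poljak_rodl_le[OF F chi_F E chi_E colouring_graph_prod_exp_graph] .
  then show ?thesis using chi_F chi_E by blast
qed

end
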